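(* Let $m>1$ and $\sigma>0$. There is no good profile $f$ to the equation $$(f^m)''(\xi)-\frac{1}{m-1}f(\xi)+\xi^{\sigma}f^{m}(\xi)=0,\qquad \xi\in[0,\infty),$$ such that $f(\xi)>0$ for every $\xi>0$.
   Context: A solution (profile) $f$ of the equation on $[0,\infty)$ is a nonnegative continuous function on $[0,\infty)$ with $f^m\in C^2([0,\infty))$ satisfying the equation. A solution $f$ of the equation is a good profile if it fulfills one of the following two properties: (P1) $f(0)=a>0$ and $f'(0)=0$; (P2) $f(0)=0$ and $(f^m)'(0)=0$. *)

theory Defs
  imports "HOL-Analysis.Analysis"
begin

text \<open>
  Functions on the half-line are total functions \<open>real \<Rightarrow> real\<close> whose values at negative
  arguments are irrelevant: all derivatives are taken within \<open>{0..}\<close>, so they are one-sided at 0.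
\<close>

definition halfline_deriv :: "(real \<Rightarrow> real) \<Rightarrow> real \<Rightarrow> real" where
  "halfline_deriv g x = vector_derivative g (at x within {0..})"

definition C2_halfline :: "(real \<Rightarrow> real) \<Rightarrow> bool" where
  "C2_halfline g \<longleftrightarrow>
     g differentiable_on {0..} \<and>
     halfline_deriv g differentiable_on {0..} \<and>
     continuous_on {0..} (halfline_deriv (halfline_deriv g))"

text \<open>
  Since \<open>0 powr a = 0\<close>, both powers below take the intended value 0 at a zero base
  (recall \<open>m > 1\<close> and \<open>\<sigma> > 0\<close>).
\<close>

definition profile :: "real \<Rightarrow> real \<Rightarrow> (real \<Rightarrow> real) \<Rightarrow> bool" where
  "profile m \<sigma> f \<longleftrightarrow>
     (\<forall>\<xi>\<ge>0. f \<xi> \<ge> 0) \<and>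
     continuous_on {0..} f \<and>
     C2_halfline (\<lambda>\<xi>. f \<xi> powr m) \<and>
     (\<forall>\<xi>\<ge>0. halfline_deriv (halfline_deriv (\<lambda>\<xi>. f \<xi> powr m)) \<xi>
              - 1 / (m - 1) * f \<xi> + \<xi> powr \<sigma> * f \<xi> powr m = 0)"

definition good_profile :: "real \<Rightarrow> real \<Rightarrow> (real \<Rightarrow> real) \<Rightarrow> bool" where
  "good_profile m \<sigma> f \<longleftrightarrow>
     profile m \<sigma> f \<and>
     (f 0 > 0 \<and> (f has_real_derivative 0) (at 0 within {0..}) \<or>
      f 0 = 0 \<and> ((\<lambda>\<xi>. f \<xi> powr m) has_real_derivative 0) (at 0 within {0..}))"

end

theory Submission
  imports Defs
begin

text \<open>
  Put \<open>g = f\<^sup>m\<close>, \<open>d = (m - 1) / (2 m)\<close>, \<open>z = g\<^sup>d\<close> and \<open>v = g' / g\<^bsup>1-d\<^esup>\<close>; then \<open>z' = d v\<close> and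
  \<open>z v' = k - s - (1 - d) v\<^sup>2\<close> with \<open>s = x\<^sup>\<sigma> z\<^sup>2\<close> and \<open>k = 1 / (m - 1)\<close>. The energy
  \<open>E = g'\<^sup>2 / 2 + x\<^sup>\<sigma> g\<^sup>2 / 2 - k g\<^bsup>2(1-d)\<^esup> / (2 (1 - d))\<close> is nondecreasing. If it is ever
  nonnegative, then \<open>z\<close> is concave with \<open>z'' + d\<^sup>2 x\<^sup>\<sigma> z \<le> 0\<close> from then on and has to vanish; so
  \<open>E < 0\<close>, that is \<open>v\<^sup>2 + s < h = k / (1 - d)\<close>.

  Let \<open>a = \<sigma> (1 - d) / d\<close>. If \<open>a \<ge> 1\<close>, the Pohozaev-type quantity \<open>x E + g g' / (2 (1 - d))\<close> increases
  from its limit 0 at the origin (here \<open>g'(0) = 0\<close> enters), so \<open>g' > 0\<close> everywhere, contradicting \<open>s < h\<close>.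
  If \<open>a < 1\<close>, let \<open>-\<kappa> x\<^bsup>-a\<^esup>\<close> be the least potential energy at \<open>x\<close> and \<open>\<alpha> = \<sigma> / (2 d)\<close>; then
  \<open>P = x (E + \<kappa> x\<^bsup>-a\<^esup>) + \<alpha> g g'\<close> increases from 0. This keeps the rescaled excess energy
  \<open>Q = x\<^bsup>a-1\<^esup> P\<close> away from 0, so the solution keeps oscillating with definite amplitude. A virial
  quantity \<open>\<Psi>\<close> turns this into growth: \<open>(K Q + \<Psi>)' \<ge> const / x\<close>, although \<open>Q\<close> and \<open>\<Psi>\<close> are bounded.
\<close>

section \<open>Tools: monotonicity from a one-sided limit, and a compactness estimate\<close>

text \<open>Monotonicity gives \<open>f t \<le> f x\<close> for \<open>0 < t < x\<close>; let
  \<open>t\<close> tend to 0. It serves both Pohozaev-type quantities, which are controlled at the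
  origin only through their limits.\<close>

lemma nonneg_of_tendsto_0_at_right:
  fixes f :: "real \<Rightarrow> real"
  assumes "(f \<longlongrightarrow> 0) (at_right 0)"
    and "\<And>x. x > 0 \<Longrightarrow> \<exists>D. (f has_real_derivative D) (at x) \<and> 0 \<le> D"
    and "x > 0"
  shows "f x \<ge> 0"
proof (rule tendsto_upperbound[OF assms(1)])
  have "eventually (\<lambda>t. t \<in> {0<..<x}) (at_right 0)"
    using \<open>x > 0\<close> by (rule eventually_at_right_real)
  then show "eventually (\<lambda>t. f t \<le> f x) (at_right 0)"
  proof eventually_elim
    case (elim t)
    show ?case
    proof (rule DERIV_nonneg_imp_nondecreasing[of t x f])
      show "\<exists>D. (f has_real_derivative D) (at u) \<and> 0 \<le> D" if "t \<le> u" "u \<le> x" for u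
        using elim that by (intro assms(2)) simp
    qed (use elim in simp)
  qed
qed simp

text \<open>Where \<open>H\<close> is nonpositive, \<open>G\<close> is bounded away from 0 by compactness.\<close>

lemma compact_penalty:
  fixes H G :: "'a::topological_space \<Rightarrow> real"
  assumes "compact K" "continuous_on K H" "continuous_on K G"
    and G_nonneg: "\<And>x. x \<in> K \<Longrightarrow> 0 \<le> G x"
    and H_pos: "\<And>x. x \<in> K \<Longrightarrow> G x = 0 \<Longrightarrow> 0 < H x"
  obtains C e where "0 \<le> C" "0 < e" "\<And>x. x \<in> K \<Longrightarrow> e \<le> H x + C * G x"
proof (cases "K = {}")
  case True
  then show ?thesis using that[of 0 1] by simp
next
  case False
  have "\<exists>C\<ge>0. \<forall>x\<in>K. 0 < H x + C * G x"
  proof (cases "{x \<in> K. H x \<le> 0} = {}")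
    case True
    then show ?thesis by (intro exI[of _ 0]) auto
  next
    case nonempty: False
    have "closedin (top_of_set K) {x \<in> K. H x \<le> 0}"
      using continuous_closedin_preimage[OF \<open>continuous_on K H\<close> closed_atMost[of 0]]
      by (simp add: vimage_def Int_def)
    then have "compact {x \<in> K. H x \<le> 0}"
      using \<open>compact K\<close> closedin_compact by blast
    then obtain y where y: "y \<in> K" "H y \<le> 0" "\<And>x. x \<in> K \<Longrightarrow> H x \<le> 0 \<Longrightarrow> G y \<le> G x"
      using continuous_attains_inf[OF _ nonempty continuous_on_subset[OF \<open>continuous_on K G\<close>]]
      by auto
    obtain w where w: "w \<in> K" "\<And>x. x \<in> K \<Longrightarrow> H w \<le> H x"
      using continuous_attains_inf[OF \<open>compact K\<close> False \<open>continuous_on K H\<close>] by auto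
    have "G y > 0"
      using G_nonneg[OF y(1)] H_pos[OF y(1)] y(2) by fastforce
    \<comment> \<open>Where \<open>H \<le> 0\<close>, \<open>G\<close> is at least its minimum
      \<open>G y\<close> on that set, so this multiple adds at least
      \<open>\<bar>H w\<bar> + 1\<close>, more than the overall minimum \<open>H w\<close> can take
      away.\<close>
    have "0 < H x + (\<bar>H w\<bar> + 1) / G y * G x" if "x \<in> K" for x
    proof (cases "H x \<le> 0")
      case True
      then have "(\<bar>H w\<bar> + 1) / G y * G y \<le> (\<bar>H w\<bar> + 1) / G y * G x"
        using y(3)[OF that] \<open>G y > 0\<close> by (intro mult_left_mono) auto
      then show ?thesis
        using w(2)[OF that] \<open>G y > 0\<close> by simp
    next
      case False
      then show ?thesis
        using \<open>G y > 0\<close> G_nonneg[OF that] by (intro add_pos_nonneg) auto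
    qed
    then show ?thesis
      using \<open>G y > 0\<close> by (intro exI[of _ "(\<bar>H w\<bar> + 1) / G y"]) auto
  qed
  then obtain C where C: "C \<ge> 0" "\<And>x. x \<in> K \<Longrightarrow> 0 < H x + C * G x"
    by blast
  have "continuous_on K (\<lambda>x. H x + C * G x)"
    by (intro continuous_intros assms)
  from continuous_attains_inf[OF \<open>compact K\<close> False this]
  obtain y where "y \<in> K" "\<And>x. x \<in> K \<Longrightarrow> H y + C * G y \<le> H x + C * G x"
    by auto
  then show ?thesis
    using that[of C "H y + C * G y"] C by blast
qed

lemma mult_le_abs:
  fixes b u :: real
  assumes "0 \<le> b" "b \<le> 1"
  shows "b * u \<le> \<bar>u\<bar>"
  using mult_left_mono[OF abs_ge_self[of u] assms(1)] mult_right_mono[OF assms(2), of "\<bar>u\<bar>"] by simp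

text \<open>Phase variables avoid all powers of the profile; positivity and the equation are only
  needed away from the origin.\<close>

locale positive_solution =
  fixes d h \<sigma> :: real and z v :: "real \<Rightarrow> real"
  assumes d_pos: "0 < d" and d_less: "d < 1/2" and h_pos: "0 < h" and \<sigma>_pos: "0 < \<sigma>"
    and z_pos: "x > 0 \<Longrightarrow> 0 < z x"
    and z_deriv: "x > 0 \<Longrightarrow> (z has_real_derivative d * v x) (at x)"
    and v_deriv: "x > 0 \<Longrightarrow>
      (v has_real_derivative ((1 - d) * (h - (v x)\<^sup>2) - x powr \<sigma> * (z x)\<^sup>2) / z x) (at x)"
begin

section \<open>The energy and the derivatives of the phase quantities\<close>

definition c :: real where "c = (1 - d) / d"
definition k :: real where "k = (1 - d) * h"
definition s :: "real \<Rightarrow> real" where "s x = x powr \<sigma> * (z x)\<^sup>2"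
text \<open>In terms of the profile this is \<open>g powr (2 * (1 - d))\<close>. Thus
  \<open>\<zeta> * v\<^sup>2\<close> is the square of g' and \<open>\<zeta> * s\<close> is
  \<open>x powr \<sigma> * g\<^sup>2\<close>, which identifies \<open>E\<close> with the energy;
  \<open>G\<close> is the product of g and g'.\<close>

definition \<zeta> :: "real \<Rightarrow> real" where "\<zeta> x = z x powr (2 * c)"
definition E :: "real \<Rightarrow> real" where "E x = \<zeta> x * ((v x)\<^sup>2 + s x - h) / 2"

definition G :: "real \<Rightarrow> real" where "G x = \<zeta> x * z x * v x"

lemma c_pos: "c > 0" and k_pos: "k > 0" and h_gt: "h > k" and cd: "c * d = 1 - d"
  using d_pos d_less h_pos by (auto simp: c_def k_def field_simps)

lemma s_pos: "x > 0 \<Longrightarrow> s x > 0"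
  using z_pos[of x] by (simp add: s_def)

lemma v_deriv': "x > 0 \<Longrightarrow>
    (v has_real_derivative (k - s x - (1 - d) * (v x)\<^sup>2) / z x) (at x)"
  using v_deriv[of x] by (simp add: s_def k_def algebra_simps)

lemma s_deriv:
  assumes "x > 0"
  shows "(s has_real_derivative \<sigma> * s x / x + 2 * d * v x * s x / z x) (at x)"
proof -
  note [derivative_intros] = z_deriv[OF assms]
  have "((\<lambda>x. x powr \<sigma> * (z x)\<^sup>2) has_real_derivative
      \<sigma> * x powr (\<sigma> - 1) * (z x)\<^sup>2 + x powr \<sigma> * (2 * z x * (d * v x))) (at x)"
    using assms by (auto intro!: derivative_eq_intros)
  then show ?thesis
    using assms z_pos[OF assms] unfolding s_def[abs_def]
    by (elim DERIV_cong) (simp add: powr_diff field_simps power2_eq_square)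
qed

lemma \<zeta>_pos: "x > 0 \<Longrightarrow> \<zeta> x > 0"
  using z_pos[of x] by (simp add: \<zeta>_def)

lemma \<zeta>_deriv:
  assumes "x > 0"
  shows "(\<zeta> has_real_derivative 2 * (1 - d) * v x * \<zeta> x / z x) (at x)"
proof -
  note [derivative_intros] = z_deriv[OF assms]
  have "((\<lambda>x. z x powr (2 * c)) has_real_derivative 2 * c * z x powr (2 * c - 1) * (d * v x)) (at x)"
    using z_pos[OF assms] by (auto intro!: derivative_eq_intros)
  moreover have "2 * c * z x powr (2 * c - 1) * (d * v x) = 2 * (c * d) * v x * (z x powr (2 * c) / z x)"
    using z_pos[OF assms] by (simp add: powr_diff)
  ultimately show ?thesis
    by (simp add: cd \<zeta>_def[abs_def])
qed

text \<open>The terms containing \<open>v\<close> cancel along solutions; only the explicit factor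
  \<open>x powr \<sigma>\<close> of the potential changes the energy.\<close>

lemma E_deriv:
  assumes "x > 0"
  shows "(E has_real_derivative \<sigma> * s x * \<zeta> x / (2 * x)) (at x)"
proof -
  define z' v' s' where "z' = 2 * (1 - d) * v x * \<zeta> x / z x"
    and "v' = (k - s x - (1 - d) * (v x)\<^sup>2) / z x"
    and "s' = \<sigma> * s x / x + 2 * d * v x * s x / z x"
  note [derivative_intros] = \<zeta>_deriv[OF assms, folded z'_def] s_deriv[OF assms, folded s'_def]
    v_deriv'[OF assms, folded v'_def]
  have "(E has_real_derivative
     (z' * ((v x)\<^sup>2 + s x - h) + \<zeta> x * (2 * v x * v' + s')) / 2) (at x)"
    unfolding E_def[abs_def] by (auto intro!: derivative_eq_intros)
  moreover define r where "r = \<zeta> x / z x"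
  have r: "\<zeta> x = r * z x" "z x \<noteq> 0"
    using z_pos[OF assms] by (auto simp: r_def)
  have "z' * ((v x)\<^sup>2 + s x - h) + \<zeta> x * (2 * v x * v' + s') = \<sigma> * s x * \<zeta> x / x"
    using r(2) assms unfolding r(1) k_def z'_def v'_def s'_def
    by (simp add: field_simps power2_eq_square)
  ultimately show ?thesis
    by (simp add: mult.commute)
qed

lemma G_deriv:
  assumes "x > 0"
  shows "(G has_real_derivative \<zeta> x * ((v x)\<^sup>2 + k - s x)) (at x)"
proof -
  note [derivative_intros] = \<zeta>_deriv[OF assms] z_deriv[OF assms] v_deriv'[OF assms]
  have "(G has_real_derivative
     (2 * (1 - d) * v x * \<zeta> x / z x * z x + \<zeta> x * (d * v x)) * v x
      + \<zeta> x * z x * ((k - s x - (1 - d) * (v x)\<^sup>2) / z x)) (at x)"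
    unfolding G_def[abs_def] by (auto intro!: derivative_eq_intros simp: algebra_simps)
  then show ?thesis
    using z_pos[OF assms]
    by (elim DERIV_cong) (simp add: field_simps power2_eq_square)
qed

lemma E_mono: "E x \<le> E y" if "0 < x" "x \<le> y"
proof (rule DERIV_nonneg_imp_nondecreasing[OF \<open>x \<le> y\<close>])
  fix t assume "x \<le> t" "t \<le> y"
  then show "\<exists>D. (E has_real_derivative D) (at t) \<and> 0 \<le> D"
    using that \<sigma>_pos E_deriv[of t] s_pos[of t] \<zeta>_pos[of t]
    by (intro exI[of _ "\<sigma> * s t * \<zeta> t / (2 * t)"]) auto
qed

section \<open>Negativity of the energy\<close>

lemma nonneg_energy_imp_concave:
  assumes "x > 0" "E x \<ge> 0"
  shows "(k - s x - (1 - d) * (v x)\<^sup>2) / z x \<le> - d * x powr \<sigma> * z x"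
proof -
  have "(v x)\<^sup>2 + s x - h \<ge> 0"
    using assms \<zeta>_pos[OF assms(1)] by (simp add: E_def zero_le_mult_iff)
  \<comment> \<open>The factor \<open>1 - d\<close> turns \<open>h\<close> into \<open>k\<close> and
    leaves exactly \<open>d * s x\<close> of the restoring term to spare.\<close>
  then have "(1 - d) * ((v x)\<^sup>2 + s x - h) \<ge> 0"
    using d_less by simp
  then have "k - s x - (1 - d) * (v x)\<^sup>2 \<le> - d * s x"
    by (simp add: k_def algebra_simps)
  then show ?thesis
    using z_pos[OF assms(1)] by (simp add: divide_simps s_def power2_eq_square algebra_simps)
qed

text \<open>Once nonnegative, the energy stays so and \<open>z\<close> is concave. A positive
  concave function on a half-line never has negative slope, so \<open>z\<close> is nondecreasing;
  but then its slope falls at a fixed rate and does become negative.\<close>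

lemma E_neg:
  assumes "x0 > 0"
  shows "E x0 < 0"
proof (rule ccontr)
  assume "\<not> E x0 < 0"
  then have E: "E x \<ge> 0" if "x \<ge> x0" for x
    using E_mono[OF assms that] by simp
  \<comment> \<open>Used twice: \<open>B = 0\<close> makes \<open>v\<close> nonincreasing, a
    positive \<open>B\<close> makes it fall linearly.\<close>
  have v_decr: "v y \<le> v x - B * (y - x)" if "x0 \<le> x" "x \<le> y"
    and B: "\<And>t. x \<le> t \<Longrightarrow> B \<le> d * t powr \<sigma> * z t" for x y B
  proof -
    have "v y + B * y \<le> v x + B * x"
    proof (rule DERIV_nonpos_imp_nonincreasing[OF \<open>x \<le> y\<close>])
      fix t assume t: "x \<le> t" "t \<le> y"
      then have "t > 0" "t \<ge> x0" using that assms by auto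
      then have "(k - s t - (1 - d) * (v t)\<^sup>2) / z t + B \<le> 0"
        using nonneg_energy_imp_concave[OF \<open>t > 0\<close> E] B[OF \<open>x \<le> t\<close>] by simp
      moreover have "((\<lambda>t. v t + B * t) has_real_derivative
          (k - s t - (1 - d) * (v t)\<^sup>2) / z t + B) (at t)"
        using v_deriv'[OF \<open>t > 0\<close>] by (auto intro!: derivative_eq_intros)
      ultimately show "\<exists>D. ((\<lambda>t. v t + B * t) has_real_derivative D) (at t) \<and> D \<le> 0"
        by blast
    qed
    then show ?thesis by (simp add: algebra_simps)
  qed
  have v_nonneg: "v x \<ge> 0" if "x \<ge> x0" for x
  proof (rule ccontr)
    assume "\<not> v x \<ge> 0"
    then have neg: "v x < 0" by simp
    have "x > 0" using that assms by simp
    have tangent: "z y \<le> z x + d * v x * (y - x)" if "y \<ge> x" for y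
    proof -
      have "z y - d * v x * y \<le> z x - d * v x * x"
      proof (rule DERIV_nonpos_imp_nonincreasing[OF that])
        fix t assume "x \<le> t" "t \<le> y"
        then have "v t \<le> v x"
          using v_decr[of x t 0] \<open>x \<ge> x0\<close> \<open>x > 0\<close> z_pos d_pos by (simp add: less_imp_le)
        moreover have "((\<lambda>t. z t - d * v x * t) has_real_derivative d * v t - d * v x) (at t)"
          using z_deriv[of t] \<open>x \<le> t\<close> \<open>x > 0\<close> by (auto intro!: derivative_eq_intros)
        ultimately show "\<exists>D. ((\<lambda>t. z t - d * v x * t) has_real_derivative D) (at t) \<and> D \<le> 0"
          using d_pos by (intro exI[of _ "d * v t - d * v x"]) auto
      qed
      then show ?thesis by (simp add: algebra_simps)
    qed
    \<comment> \<open>The zero of the tangent line to \<open>z\<close> at \<open>x\<close>.\<close>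
    define y where "y = x - z x / (d * v x)"
    have "z x / (d * v x) < 0"
      using neg d_pos z_pos[OF \<open>x > 0\<close>] by (simp add: divide_pos_neg mult_pos_neg)
    then have "y > x"
      by (simp add: y_def)
    then have "z y \<le> z x + d * v x * (y - x)"
      by (simp add: tangent)
    moreover have "z x + d * v x * (y - x) = 0"
      using neg d_pos by (simp add: y_def)
    ultimately show False
      using z_pos[of y] \<open>x > 0\<close> \<open>y > x\<close> by linarith
  qed
  have z_ge: "z x \<ge> z x0" if "x \<ge> x0" for x
  proof (rule DERIV_nonneg_imp_nondecreasing[OF that])
    fix t assume "x0 \<le> t" "t \<le> x"
    then show "\<exists>D. (z has_real_derivative D) (at t) \<and> 0 \<le> D"
      using z_deriv[of t] v_nonneg[of t] d_pos assms by (intro exI[of _ "d * v t"]) auto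
  qed
  define B where "B = d * x0 powr \<sigma> * z x0"
  have "B > 0"
    using d_pos assms z_pos[OF assms] by (simp add: B_def)
  have "B \<le> d * t powr \<sigma> * z t" if "x0 \<le> t" for t
    unfolding B_def using that assms d_pos \<sigma>_pos z_ge[OF that] z_pos[OF assms]
    by (intro mult_mono powr_mono2) auto
  \<comment> \<open>At this point the linear upper bound has dropped to -1.\<close>
  then have "v (x0 + (v x0 + 1) / B) \<le> v x0 - B * (x0 + (v x0 + 1) / B - x0)"
    using \<open>B > 0\<close> v_nonneg[of x0] by (intro v_decr) auto
  also have "\<dots> < 0"
    using \<open>B > 0\<close> by (simp add: field_simps)
  finally show False
    using v_nonneg[of "x0 + (v x0 + 1) / B"] v_nonneg[of x0] \<open>B > 0\<close> by simp
qed

section \<open>A priori bounds from negative energy\<close>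

lemma bound: "x > 0 \<Longrightarrow> (v x)\<^sup>2 + s x < h"
  using E_neg[of x] \<zeta>_pos[of x] by (simp add: E_def mult_less_0_iff)

lemma z_sq_le:
  assumes "x > 0"
  shows "(z x)\<^sup>2 \<le> h * x powr (- \<sigma>)"
proof -
  have "(z x)\<^sup>2 = s x * x powr (- \<sigma>)"
    using assms by (simp add: s_def powr_minus)
  also have "\<dots> \<le> h * x powr (- \<sigma>)"
    using bound[OF assms] zero_le_power2[of "v x"]
    by (intro mult_right_mono) (linarith, simp)
  finally show ?thesis .
qed

lemma s_less: "x > 0 \<Longrightarrow> s x < h"
  using bound[of x] zero_le_power2[of "v x"] by linarith

lemma v_sq_less: "x > 0 \<Longrightarrow> (v x)\<^sup>2 < h"
  using bound[of x] s_pos[of x] by linarith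

text \<open>\<open>v\<close> is bounded and \<open>z\<close> decays like
  \<open>x powr (- \<sigma> / 2)\<close>. This makes every cross term containing
  \<open>z x * v x / x\<close> negligible at infinity.\<close>

lemma abs_zv_le:
  assumes "x > 0"
  shows "\<bar>z x * v x / x\<bar> \<le> h * x powr (- 1 - \<sigma> / 2)"
proof -
  have "(z x * v x)\<^sup>2 \<le> (h * x powr (- \<sigma>)) * h"
    unfolding power_mult_distrib
    using z_sq_le[OF assms] v_sq_less[OF assms] h_pos by (intro mult_mono) auto
  also have "\<dots> = (h * x powr (- \<sigma> / 2))\<^sup>2"
    using assms by (simp add: power2_eq_square powr_add[symmetric])
  finally have "\<bar>z x * v x\<bar> \<le> \<bar>h * x powr (- \<sigma> / 2)\<bar>"
    by (simp only: abs_le_square_iff)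
  then have le: "\<bar>z x * v x\<bar> \<le> h * x powr (- \<sigma> / 2)"
    using h_pos by (simp only: abs_mult abs_of_pos abs_of_nonneg powr_ge_zero)
  have exponent: "- 1 - \<sigma> / 2 = - \<sigma> / 2 - 1"
    by (simp only: diff_conv_add_uminus minus_divide_left add.commute)
  have "\<bar>z x * v x / x\<bar> = \<bar>z x * v x\<bar> / x"
    using assms by simp
  also have "\<dots> \<le> h * x powr (- \<sigma> / 2) / x"
    using assms by (intro divide_right_mono le) simp
  also have "\<dots> = h * x powr (- 1 - \<sigma> / 2)"
    unfolding exponent powr_diff using assms by simp
  finally show ?thesis .
qed

text \<open>Equal to \<open>x powr (\<sigma> * c) * \<zeta> x\<close>. Rescaling the energy by this
  power of \<open>x\<close> leaves a function of \<open>s\<close> and \<open>v\<close> alone, so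
  that compactness in the phase plane becomes available.\<close>

definition \<theta> :: "real \<Rightarrow> real" where "\<theta> x = s x powr c"

lemma \<theta>_pos: "x > 0 \<Longrightarrow> \<theta> x > 0"
  using s_pos[of x] by (simp add: \<theta>_def)

lemma \<theta>_le: "x > 0 \<Longrightarrow> \<theta> x \<le> h powr c"
  using s_pos[of x] s_less[of x] c_pos by (simp add: \<theta>_def powr_mono2)

lemma \<theta>_eq: "x > 0 \<Longrightarrow> \<theta> x = x powr (\<sigma> * c) * \<zeta> x"
  using z_pos[of x] powr_powr[of "z x" 2 c]
  by (simp add: \<theta>_def s_def \<zeta>_def powr_mult powr_powr[of x \<sigma> c])

lemma \<theta>_deriv:
  assumes "x > 0"
  shows "(\<theta> has_real_derivative \<theta> x * (\<sigma> * c / x + 2 * (1 - d) * v x / z x)) (at x)"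
proof -
  note [derivative_intros] = s_deriv[OF assms]
  have "(\<theta> has_real_derivative c * s x powr (c - 1) * (\<sigma> * s x / x + 2 * d * v x * s x / z x)) (at x)"
    unfolding \<theta>_def[abs_def] using s_pos[OF assms] by (auto intro!: derivative_eq_intros)
  moreover have "c * s x powr (c - 1) * (\<sigma> * s x / x + 2 * d * v x * s x / z x)
     = s x * s x powr (c - 1) * (\<sigma> * c / x + 2 * (c * d) * v x / z x)"
    by (simp add: algebra_simps)
  moreover have "s x * s x powr (c - 1) = \<theta> x"
    using s_pos[OF assms] by (simp add: \<theta>_def powr_mult_base)
  ultimately show ?thesis
    by (simp add: cd)
qed

end

text \<open>The flux \<open>z x powr ((1 - d) / d) * v x\<close> is g' in phase variables. Since
  \<open>z0\<close> may be positive or 0, both kinds of good profile are covered.\<close>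

locale good_solution = positive_solution +
  fixes z0 :: real
  assumes z_lim: "(z \<longlongrightarrow> z0) (at_right 0)"
    and flux_lim: "((\<lambda>x. z x powr ((1 - d) / d) * v x) \<longlongrightarrow> 0) (at_right 0)"
begin

section \<open>Limits at the origin\<close>

lemmas flux_lim_c = flux_lim[folded c_def]

lemma \<zeta>_lim: "(\<zeta> \<longlongrightarrow> z0 powr (2 * c)) (at_right 0)"
proof -
  \<comment> \<open>As \<open>z0\<close> may be 0, the limit of the power rests on
    \<open>z \<ge> 0\<close> near the origin and a positive exponent.\<close>
  have "eventually (\<lambda>x. 0 \<le> z x) (at_right 0)"
    using eventually_at_right_less by eventually_elim (simp add: z_pos less_imp_le)
  then show ?thesis
    unfolding \<zeta>_def[abs_def] using c_pos by (intro tendsto_powr' z_lim tendsto_const) simp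
qed

lemma s_lim: "(s \<longlongrightarrow> 0) (at_right 0)"
proof -
  have "((\<lambda>x. x powr \<sigma>) \<longlongrightarrow> 0 powr \<sigma>) (at_right 0)"
    using \<sigma>_pos eventually_mono[OF eventually_at_right_less[of "0::real"] less_imp_le]
    by (intro tendsto_powr' tendsto_intros disjI2 conjI)
  then have "((\<lambda>x. x powr \<sigma> * (z x)\<^sup>2) \<longlongrightarrow> 0 powr \<sigma> * z0\<^sup>2) (at_right 0)"
    by (intro tendsto_mult tendsto_power z_lim)
  then show ?thesis by (simp add: s_def[abs_def])
qed

text \<open>Splitting \<open>\<zeta>\<close> into two equal powers of \<open>z\<close> pairs one of
  them with \<open>v\<close>, which exhibits the vanishing flux as a factor.\<close>

lemma G_lim: "(G \<longlongrightarrow> 0) (at_right 0)"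
proof -
  have "eventually (\<lambda>x. 0 \<le> z x) (at_right 0)"
    using eventually_at_right_less by eventually_elim (simp add: z_pos less_imp_le)
  then have "((\<lambda>x. z x powr c) \<longlongrightarrow> z0 powr c) (at_right 0)"
    using c_pos by (intro tendsto_powr' z_lim tendsto_const disjI2 conjI)
  then have "((\<lambda>x. z x powr c * z x * (z x powr c * v x)) \<longlongrightarrow> z0 powr c * z0 * 0) (at_right 0)"
    by (intro tendsto_mult z_lim flux_lim_c)
  moreover have "\<zeta> x = z x powr c * z x powr c" for x
    by (simp add: \<zeta>_def flip: powr_add)
  ultimately show ?thesis
    by (simp add: G_def[abs_def] mult_ac)
qed

lemma xE_lim: "((\<lambda>x. x * E x) \<longlongrightarrow> 0) (at_right 0)"
proof -
  have "((\<lambda>x. x * (((z x powr c * v x)\<^sup>2 + \<zeta> x * (s x - h)) / 2))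
      \<longlongrightarrow> 0 * ((0\<^sup>2 + z0 powr (2 * c) * (0 - h)) / 2)) (at_right 0)"
    by (intro tendsto_intros flux_lim_c \<zeta>_lim s_lim) auto
  moreover have "\<zeta> x = (z x powr c)\<^sup>2" for x
    by (simp add: \<zeta>_def power2_eq_square flip: powr_add)
  ultimately show ?thesis
    by (simp add: E_def algebra_simps)
qed

section \<open>Exclusion of large exponents by a Pohozaev-type quantity\<close>

lemma \<sigma>_c_less_1: "\<sigma> * c < 1"
proof (rule ccontr)
  assume "\<not> \<sigma> * c < 1"
  then have \<sigma>_ge: "\<sigma> * (1 - d) \<ge> d"
    using d_pos by (simp add: c_def field_simps)
  \<comment> \<open>The weight of \<open>G\<close> makes its \<open>k\<close> term cancel the
    \<open>h\<close> term of \<open>E\<close> in the derivative; what is left has nonnegative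
    coefficients exactly because \<open>\<sigma> * (1 - d) \<ge> d\<close>.\<close>
  define P where "P x = x * E x + G x / (2 * (1 - d))" for x
  have P_nonneg: "P x \<ge> 0" if "x > 0" for x
  proof (rule nonneg_of_tendsto_0_at_right[OF _ _ that])
    show "(P \<longlongrightarrow> 0) (at_right 0)"
      unfolding P_def[abs_def]
      using tendsto_add[OF xE_lim tendsto_divide_zero[OF G_lim]] by simp
  next
    fix x :: real assume x: "x > 0"
    define e g where "e = \<sigma> * s x * \<zeta> x / (2 * x)" and "g = \<zeta> x * ((v x)\<^sup>2 + k - s x)"
    note [derivative_intros] = E_deriv[OF x, folded e_def] G_deriv[OF x, folded g_def]
    have "(P has_real_derivative E x + x * e + g / (2 * (1 - d))) (at x)"
      unfolding P_def[abs_def] using d_less by (auto intro!: derivative_eq_intros)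
    moreover have "2 * (1 - d) * E x + 2 * (1 - d) * (x * e) + g
      = \<zeta> x * ((v x)\<^sup>2 * (2 - d) + s x * (\<sigma> * (1 - d) - d))"
      unfolding E_def e_def g_def k_def using x by (simp add: field_simps)
    moreover have "\<dots> \<ge> 0"
      using \<zeta>_pos[OF x] s_pos[OF x] d_less \<sigma>_ge by simp
    ultimately have "0 \<le> (2 * (1 - d)) * (E x + x * e + g / (2 * (1 - d)))"
      using d_less by (simp add: distrib_left)
    then have "0 \<le> E x + x * e + g / (2 * (1 - d))"
      using d_less by (simp add: zero_le_mult_iff)
    then show "\<exists>D. (P has_real_derivative D) (at x) \<and> 0 \<le> D"
      using \<open>(P has_real_derivative E x + x * e + g / (2 * (1 - d))) (at x)\<close> by blast
  qed
  \<comment> \<open>As the energy is negative, \<open>P x \<ge> 0\<close> forces \<open>G x\<close>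
    to be positive.\<close>
  have v_pos: "v x > 0" if "x > 0" for x
  proof -
    have "x * E x < 0"
      using E_neg[OF that] that by (simp add: mult_pos_neg)
    then have "G x / (2 * (1 - d)) > 0"
      using P_nonneg[OF that] by (simp add: P_def)
    then have "\<zeta> x * z x * v x > 0"
      using d_less by (simp add: G_def zero_less_divide_iff)
    then show ?thesis
      using \<zeta>_pos[OF that] z_pos[OF that] zero_less_mult_pos[of "\<zeta> x * z x" "v x"] by simp
  qed
  have "z x \<ge> z 1" if "x \<ge> 1" for x
  proof (rule DERIV_nonneg_imp_nondecreasing[OF that])
    fix t :: real assume "1 \<le> t" "t \<le> x"
    then show "\<exists>D. (z has_real_derivative D) (at t) \<and> 0 \<le> D"
      using z_deriv[of t] v_pos[of t] d_pos by (intro exI[of _ "d * v t"]) auto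
  qed
  then have "(z 1)\<^sup>2 \<le> (z x)\<^sup>2" if "x \<ge> 1" for x
    using that z_pos[of 1] by (intro power_mono) auto
  then have le: "(z 1)\<^sup>2 \<le> h * x powr (- \<sigma>)" if "x \<ge> 1" for x
    using z_sq_le[of x] that by fastforce
  have "((\<lambda>x. h * x powr (- \<sigma>)) \<longlongrightarrow> h * 0) at_top"
    using \<sigma>_pos by (intro tendsto_intros tendsto_neg_powr filterlim_ident) auto
  then have "(z 1)\<^sup>2 \<le> h * 0"
    by (rule tendsto_lowerbound) (use le in \<open>auto simp: eventually_at_top_linorder\<close>)
  then show False
    using z_pos[of 1] by simp
qed

section \<open>The rescaled excess energy when \<open>a < 1\<close>\<close>

definition a :: real where "a = \<sigma> * c"
text \<open>With this weight both the \<open>s\<close> term and the constant term cancel in the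
  derivative of \<open>Q\<close>, leaving only a \<open>v\<^sup>2\<close> term and a cross
  term.\<close>

definition \<alpha> :: real where "\<alpha> = \<sigma> / (2 * d)"
definition \<kappa> :: real where "\<kappa> = k powr c * (h - k) / 2"
text \<open>This is \<open>x powr a * E x + \<kappa>\<close>. Here \<kappa> is half the maximum of
  \<open>t powr c * (h - t)\<close>, attained at \<open>t = k\<close>, so \<open>F\<close> measures
  the height above the bottom of the potential well.\<close>

definition F :: "real \<Rightarrow> real" where "F x = \<theta> x * ((v x)\<^sup>2 + s x - h) / 2 + \<kappa>"
definition Q :: "real \<Rightarrow> real" where "Q x = F x + \<alpha> * \<theta> x * (z x * v x / x)"

lemma a_less_1: "a < 1" and a_pos: "a > 0" and \<alpha>_pos: "\<alpha> > 0" and \<kappa>_pos: "\<kappa> > 0"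
  and \<sigma>_eq: "\<sigma> = 2 * d * \<alpha>" and a_eq: "a = 2 * (1 - d) * \<alpha>"
  using \<sigma>_c_less_1 \<sigma>_pos c_pos d_pos k_pos h_gt
  by (simp_all add: a_def \<alpha>_def \<kappa>_def) (simp add: c_def field_simps)

lemma zv_deriv:
  assumes "x > 0"
  shows "((\<lambda>x. z x * v x / x) has_real_derivative
    ((k - s x - (1 - 2 * d) * (v x)\<^sup>2) - z x * v x / x) / x) (at x)"
proof -
  define v' where "v' = (k - s x - (1 - d) * (v x)\<^sup>2) / z x"
  have zv': "z x * v' = k - s x - (1 - d) * (v x)\<^sup>2"
    using z_pos[OF assms] by (simp add: v'_def)
  note [derivative_intros] = z_deriv[OF assms] v_deriv'[OF assms, folded v'_def]
  have "((\<lambda>x. z x * v x / x) has_real_derivative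
      ((d * (v x)\<^sup>2 + z x * v') * x - z x * v x) / (x * x)) (at x)"
    using assms by (auto intro!: derivative_eq_intros simp: power2_eq_square algebra_simps)
  then show ?thesis
    unfolding zv' using assms by (elim DERIV_cong) (simp add: field_simps)
qed

lemma F_deriv:
  assumes "x > 0"
  shows "(F has_real_derivative
    \<theta> x * (a * ((v x)\<^sup>2 + s x - h) + \<sigma> * s x) / (2 * x)) (at x)"
proof -
  define \<theta>' v' s' where "\<theta>' = \<theta> x * (\<sigma> * c / x + 2 * (1 - d) * v x / z x)"
    and "v' = (k - s x - (1 - d) * (v x)\<^sup>2) / z x"
    and "s' = \<sigma> * s x / x + 2 * d * v x * s x / z x"
  note [derivative_intros] = \<theta>_deriv[OF assms, folded \<theta>'_def] s_deriv[OF assms, folded s'_def]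
    v_deriv'[OF assms, folded v'_def]
  have "(F has_real_derivative
     (\<theta>' * ((v x)\<^sup>2 + s x - h) + \<theta> x * (2 * v x * v' + s')) / 2) (at x)"
    unfolding F_def[abs_def] by (auto intro!: derivative_eq_intros)
  moreover define r where "r = \<theta> x / z x"
  have r: "\<theta> x = r * z x" "z x \<noteq> 0"
    using z_pos[OF assms] by (auto simp: r_def)
  have "\<theta>' * ((v x)\<^sup>2 + s x - h) + \<theta> x * (2 * v x * v' + s')
      = \<theta> x * (a * ((v x)\<^sup>2 + s x - h) + \<sigma> * s x) / x"
    using r(2) assms unfolding \<theta>'_def r(1) k_def v'_def s'_def a_def[symmetric]
    by (simp add: field_simps power2_eq_square)
  ultimately show ?thesis
    by (simp add: mult.commute)
qed

lemma Q_deriv: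
  assumes "x > 0"
  shows "(Q has_real_derivative
    ((\<alpha> + a / 2) * \<theta> x * (v x)\<^sup>2 - (1 - a) * \<alpha> * \<theta> x * (z x * v x / x)) / x) (at x)"
proof -
  define \<theta>' f' w w' where "\<theta>' = \<theta> x * (\<sigma> * c / x + 2 * (1 - d) * v x / z x)"
    and "f' = \<theta> x * (a * ((v x)\<^sup>2 + s x - h) + \<sigma> * s x) / (2 * x)"
    and "w = (\<lambda>x. z x * v x / x)"
    and "w' = ((k - s x - (1 - 2 * d) * (v x)\<^sup>2) - z x * v x / x) / x"
  note [derivative_intros] = \<theta>_deriv[OF assms, folded \<theta>'_def] F_deriv[OF assms, folded f'_def]
    zv_deriv[OF assms, folded w'_def w_def]
  have "((\<lambda>x. F x + \<alpha> * \<theta> x * w x) has_real_derivative f' + \<alpha> * (\<theta>' * w x + \<theta> x * w')) (at x)"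
    by (auto intro!: derivative_eq_intros simp: algebra_simps)
  moreover have "\<theta>' * w x = (a * \<theta> x * w x + 2 * (1 - d) * \<theta> x * (v x)\<^sup>2) / x"
    using assms z_pos[OF assms] unfolding \<theta>'_def w_def a_def
    by (simp add: field_simps power2_eq_square)
  moreover have "\<theta> x * (a * ((v x)\<^sup>2 + s x - h) + \<sigma> * s x) / 2
      + \<alpha> * ((a * \<theta> x * w x + 2 * (1 - d) * \<theta> x * (v x)\<^sup>2)
        + \<theta> x * ((k - s x - (1 - 2 * d) * (v x)\<^sup>2) - w x))
      = (\<alpha> + a / 2) * \<theta> x * (v x)\<^sup>2 - (1 - a) * \<alpha> * \<theta> x * w x"
  proof -
    \<comment> \<open>Stated for variables tied by the two relations, so that substitution leaves an
      identity in \<open>\<alpha>'\<close> and \<open>d\<close> to be checked by algebra.\<close>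
    have "\<theta> x * (a' * ((v x)\<^sup>2 + s x - h) + \<sigma>' * s x) / 2
      + \<alpha>' * ((a' * \<theta> x * w x + 2 * (1 - d) * \<theta> x * (v x)\<^sup>2)
        + \<theta> x * ((k - s x - (1 - 2 * d) * (v x)\<^sup>2) - w x))
      = (\<alpha>' + a' / 2) * \<theta> x * (v x)\<^sup>2 - (1 - a') * \<alpha>' * \<theta> x * w x"
      if "a' = 2 * (1 - d) * \<alpha>'" "\<sigma>' = 2 * d * \<alpha>'" for a' \<sigma>' \<alpha>'
      unfolding that k_def by (simp add: field_simps)
    from this[OF a_eq \<sigma>_eq] show ?thesis .
  qed
  then have "(\<theta> x * (a * ((v x)\<^sup>2 + s x - h) + \<sigma> * s x) / 2
      + \<alpha> * ((a * \<theta> x * w x + 2 * (1 - d) * \<theta> x * (v x)\<^sup>2)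
        + \<theta> x * ((k - s x - (1 - 2 * d) * (v x)\<^sup>2) - w x))) / x
      = ((\<alpha> + a / 2) * \<theta> x * (v x)\<^sup>2 - (1 - a) * \<alpha> * \<theta> x * w x) / x"
    by (simp only:)
  moreover have "f' = \<theta> x * (a * ((v x)\<^sup>2 + s x - h) + \<sigma> * s x) / 2 / x"
    and "w' = ((k - s x - (1 - 2 * d) * (v x)\<^sup>2) - w x) / x"
    by (simp_all add: f'_def w'_def w_def)
  moreover have collect: "A / x + \<alpha> * (B / x + C * (D / x)) = (A + \<alpha> * (B + C * D)) / x" for A B C D
    by (simp add: add_divide_distrib distrib_left)
  ultimately have "((\<lambda>x. F x + \<alpha> * \<theta> x * w x) has_real_derivative
      ((\<alpha> + a / 2) * \<theta> x * (v x)\<^sup>2 - (1 - a) * \<alpha> * \<theta> x * w x) / x) (at x)"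
    by (simp only: collect)
  then show ?thesis
    unfolding Q_def[abs_def] w_def .
qed

text \<open>The potential is minimal at \<open>s = k\<close>; this is Young's inequality with weights \<open>1 - d\<close> and \<open>d\<close>.\<close>

lemma powr_mult_diff_le:
  assumes "t > 0"
  shows "t powr c * (h - t) \<le> k powr c * (h - k)"
proof (cases "t < h")
  case False
  then have "t powr c * (h - t) \<le> 0"
    by (simp add: mult_nonneg_nonpos)
  also have "\<dots> \<le> k powr c * (h - k)"
    using h_gt by simp
  finally show ?thesis .
next
  case True
  \<comment> \<open>The factor \<open>c\<close> makes the weighted mean on the right equal to
    \<open>k\<close> for every \<open>t\<close>. Raising to the power \<open>1 / d = c + 1\<close>
    then yields the claim up to the factor \<open>c\<close>.\<close>
  have "t powr (1 - d) * (c * (h - t)) powr d \<le> (1 - d) * t + d * (c * (h - t))"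
    using True d_pos d_less c_pos assms by (intro Youngs_inequality_0) auto
  also have "d * (c * (h - t)) = (1 - d) * (h - t)"
    using cd by (simp add: mult_ac)
  also have "(1 - d) * t + (1 - d) * (h - t) = k"
    by (simp add: k_def algebra_simps)
  finally have "(t powr (1 - d) * (c * (h - t)) powr d) powr (1 / d) \<le> k powr (1 / d)"
    using d_pos by (intro powr_mono2) auto
  moreover have "1 / d = c + 1"
    using d_pos by (simp add: c_def field_simps)
  moreover have "(t powr (1 - d) * (c * (h - t)) powr d) powr (c + 1) = c * (t powr c * (h - t))"
  proof -
    have "(1 - d) * (c + 1) = c" "d * (c + 1) = 1"
      using cd by (simp_all add: algebra_simps)
    then show ?thesis
      using True c_pos assms by (simp add: powr_mult powr_powr)
  qed
  moreover have "k powr (c + 1) = c * (k powr c * (h - k))"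
  proof -
    have "c * (h - k) = k"
      using d_pos by (simp add: k_def c_def field_simps)
    then show ?thesis
      using k_pos by (simp add: powr_add mult.left_commute)
  qed
  ultimately have "c * (t powr c * (h - t)) \<le> c * (k powr c * (h - k))"
    by (simp only:)
  then show ?thesis
    using c_pos by simp
qed

lemma F_ge:
  assumes "x > 0"
  shows "F x \<ge> \<theta> x * (s x - h) / 2 + \<kappa>"
proof -
  have "\<theta> x * (s x - h) \<le> \<theta> x * ((v x)\<^sup>2 + s x - h)"
    using \<theta>_pos[OF assms] by (intro mult_left_mono) auto
  then show ?thesis
    by (simp add: F_def)
qed

lemma F_nonneg:
  assumes "x > 0"
  shows "F x \<ge> 0"
proof -
  have "\<theta> x * (h - s x) \<le> 2 * \<kappa>"
    using powr_mult_diff_le[OF s_pos[OF assms]] by (simp add: \<theta>_def \<kappa>_def)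
  then show ?thesis
    using F_ge[OF assms] by (simp add: field_simps)
qed

text \<open>Near the origin \<open>s\<close> and \<open>\<theta>\<close> vanish, so the lower bound
  for \<open>F\<close> tends to \<kappa>. This supplies the strict growth of
  \<open>P\<close>.\<close>

lemma F_pos_near_0: "eventually (\<lambda>x. F x > 0) (at_right 0)"
proof -
  have "eventually (\<lambda>x. 0 \<le> s x) (at_right 0)"
    using eventually_at_right_less by eventually_elim (simp add: s_pos less_imp_le)
  then have "(\<theta> \<longlongrightarrow> 0 powr c) (at_right 0)"
    unfolding \<theta>_def[abs_def] using c_pos
    by (intro tendsto_powr' s_lim tendsto_const disjI2 conjI)
  then have "((\<lambda>x. \<theta> x * (s x - h) / 2 + \<kappa>) \<longlongrightarrow> 0 powr c * (0 - h) / 2 + \<kappa>) (at_right 0)"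
    by (intro tendsto_intros s_lim) auto
  then have "eventually (\<lambda>x. \<theta> x * (s x - h) / 2 + \<kappa> > 0) (at_right 0)"
    using \<kappa>_pos by (intro order_tendstoD(1)) auto
  then show ?thesis
    using eventually_at_right_less[of "0::real"]
  proof eventually_elim
    case (elim x)
    then show ?case
      using F_ge[of x] by simp
  qed
qed

section \<open>Monotonicity of \<open>P\<close> and a positive lower bound\<close>

definition P :: "real \<Rightarrow> real" where "P x = x powr (1 - a) * Q x"

text \<open>The exponent \<open>1 - a\<close> is the one for which the cross term of
  \<open>Q'\<close>, whose sign is unknown, cancels.\<close>

lemma P_deriv:
  assumes "x > 0"
  shows "(P has_real_derivative
    x powr (- a) * ((1 - a) * F x + (\<alpha> + a / 2) * \<theta> x * (v x)\<^sup>2)) (at x)"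
proof -
  define q' where "q' = ((\<alpha> + a / 2) * \<theta> x * (v x)\<^sup>2 - (1 - a) * \<alpha> * \<theta> x * (z x * v x / x)) / x"
  note [derivative_intros] = Q_deriv[OF assms, folded q'_def]
  have "(P has_real_derivative (1 - a) * x powr (1 - a - 1) * Q x + x powr (1 - a) * q') (at x)"
    unfolding P_def[abs_def] using assms by (auto intro!: derivative_eq_intros)
  moreover have "x powr (1 - a) = x powr (- a) * x"
    using assms powr_add[of x "- a" 1] by simp
  ultimately have "(P has_real_derivative x powr (- a) * ((1 - a) * Q x + x * q')) (at x)"
    by (simp add: algebra_simps)
  moreover have "(1 - a) * Q x + x * q' = (1 - a) * F x + (\<alpha> + a / 2) * \<theta> x * (v x)\<^sup>2"
    unfolding q'_def Q_def using assms by (simp add: field_simps)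
  ultimately show ?thesis
    by simp
qed

lemma P_deriv_nonneg: "\<exists>D. (P has_real_derivative D) (at x) \<and> 0 \<le> D" if "x > 0"
proof -
  have "0 \<le> x powr (- a) * ((1 - a) * F x + (\<alpha> + a / 2) * \<theta> x * (v x)\<^sup>2)"
    using F_nonneg[OF that] \<theta>_pos[OF that] \<alpha>_pos a_pos a_less_1 by simp
  then show ?thesis
    using P_deriv[OF that] by blast
qed

text \<open>Undoing the rescaling, \<open>P x\<close> is
  \<open>x * E x + x powr (1 - a) * \<kappa> + \<alpha> * G x\<close>; the middle term vanishes at 0
  because \<open>a < 1\<close>.\<close>

lemma P_lim: "(P \<longlongrightarrow> 0) (at_right 0)"
proof -
  have "((\<lambda>x. x powr (1 - a)) \<longlongrightarrow> 0 powr (1 - a)) (at_right 0)"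
    using a_less_1 eventually_mono[OF eventually_at_right_less[of "0::real"] less_imp_le]
    by (intro tendsto_powr' tendsto_ident_at tendsto_const disjI2 conjI) auto
  then have "((\<lambda>x. x * E x + x powr (1 - a) * \<kappa> + \<alpha> * G x) \<longlongrightarrow> 0 + 0 powr (1 - a) * \<kappa> + \<alpha> * 0)
      (at_right 0)"
    by (intro tendsto_add xE_lim tendsto_mult[OF _ tendsto_const] tendsto_mult[OF tendsto_const] G_lim)
  moreover have "eventually (\<lambda>x. x * E x + x powr (1 - a) * \<kappa> + \<alpha> * G x = P x) (at_right 0)"
    using eventually_at_right_less[of "0::real"]
  proof eventually_elim
    case (elim x)
    have "x powr (1 - a) * \<theta> x = x * \<zeta> x"
      using elim by (simp add: \<theta>_eq a_def powr_diff)
    moreover have "P x = x powr (1 - a) * \<theta> x * ((v x)\<^sup>2 + s x - h) / 2 + x powr (1 - a) * \<kappa>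
        + \<alpha> * (x powr (1 - a) * \<theta> x) * (z x * v x / x)"
      by (simp add: P_def Q_def F_def algebra_simps)
    ultimately show ?case
      using elim by (simp add: E_def G_def)
  qed
  ultimately show ?thesis
    by (simp add: tendsto_cong)
qed

lemma P_mono: "P x \<le> P y" if "0 < x" "x \<le> y"
proof (rule DERIV_nonneg_imp_nondecreasing[OF \<open>x \<le> y\<close>])
  fix t assume "x \<le> t"
  then show "\<exists>D. (P has_real_derivative D) (at t) \<and> 0 \<le> D"
    using \<open>0 < x\<close> by (intro P_deriv_nonneg) simp
qed

text \<open>\<open>P\<close> is nonnegative, strictly increasing on a short interval where
  \<open>F > 0\<close>, and never decreases afterwards.\<close>

lemma P_bounded_below:
  obtains x0 \<delta> where "x0 > 0" "\<delta> > 0" "\<And>x. x \<ge> x0 \<Longrightarrow> P x \<ge> \<delta>"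
proof -
  obtain b where b: "b > 0" "\<And>x. 0 < x \<Longrightarrow> x < b \<Longrightarrow> F x > 0"
    using F_pos_near_0 by (auto simp: eventually_at_right_field)
  have "P (b / 4) \<ge> 0"
    using b(1) by (intro nonneg_of_tendsto_0_at_right[OF P_lim P_deriv_nonneg]) auto
  also have "P (b / 4) < P (b / 2)"
  proof (rule DERIV_pos_imp_increasing[of "b / 4" "b / 2" P])
    fix t assume t: "b / 4 \<le> t" "t \<le> b / 2"
    then have "t > 0" "t < b" using b(1) by auto
    then have deriv_pos: "0 < t powr (- a) * ((1 - a) * F t + (\<alpha> + a / 2) * \<theta> t * (v t)\<^sup>2)"
      using b(2)[of t] \<theta>_pos[of t] \<alpha>_pos a_pos a_less_1 by (simp add: add_pos_nonneg)
    from \<open>t > 0\<close> show "\<exists>D. (P has_real_derivative D) (at t) \<and> 0 < D"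
      using P_deriv[of t] deriv_pos by blast
  qed (use b(1) in simp)
  finally show ?thesis
    using b(1) P_mono[of "b / 2"] by (intro that[of "b / 2" "P (b / 2)"]) auto
qed

section \<open>Decay of the cross terms and a lower bound for \<open>Q\<close>\<close>

definition \<eta> :: "real \<Rightarrow> real" where "\<eta> x = x powr (- 1 - \<sigma> / 2)"

lemma \<eta>_pos: "x > 0 \<Longrightarrow> \<eta> x > 0"
  by (simp add: \<eta>_def)

lemma \<eta>_deriv:
  assumes "x > 0"
  shows "(\<eta> has_real_derivative - (1 + \<sigma> / 2) * \<eta> x / x) (at x)"
proof -
  have "(\<eta> has_real_derivative (- 1 - \<sigma> / 2) * x powr (- 1 - \<sigma> / 2 - 1)) (at x)"
    unfolding \<eta>_def[abs_def] using assms by (auto intro!: derivative_eq_intros)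
  also have "x powr (- 1 - \<sigma> / 2 - 1) = \<eta> x / x"
    unfolding \<eta>_def powr_diff[of x "- 1 - \<sigma> / 2" 1] using assms by simp
  finally show ?thesis
    by (elim DERIV_cong) (use assms in \<open>simp add: field_simps\<close>)
qed

lemma \<eta>_lim: "(\<eta> \<longlongrightarrow> 0) at_top"
  unfolding \<eta>_def[abs_def] using \<sigma>_pos by (intro tendsto_neg_powr filterlim_ident) auto

lemma eventually_\<eta>_less: "B > 0 \<Longrightarrow> eventually (\<lambda>x. A * \<eta> x < B) at_top"
  using tendsto_mult_left[OF \<eta>_lim, of A] by (intro order_tendstoD(2)) auto

definition C0 :: real where "C0 = \<alpha> * h powr c * h"

lemma C0_pos: "C0 > 0"
  using \<alpha>_pos h_pos by (simp add: C0_def)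

lemma abs_zv_le_\<eta>: "x > 0 \<Longrightarrow> \<bar>z x * v x / x\<bar> \<le> h * \<eta> x"
  using abs_zv_le[of x] by (simp only: \<eta>_def)

lemma abs_cross_le:
  assumes "x > 0"
  shows "\<bar>\<alpha> * \<theta> x * (z x * v x / x)\<bar> \<le> C0 * \<eta> x"
proof -
  have "\<alpha> * \<theta> x * \<bar>z x * v x / x\<bar> \<le> \<alpha> * h powr c * (h * \<eta> x)"
    using \<theta>_le[OF assms] \<theta>_pos[OF assms] \<alpha>_pos abs_zv_le_\<eta>[OF assms]
    by (intro mult_mono) auto
  then show ?thesis
    using \<theta>_pos[OF assms] \<alpha>_pos by (simp add: C0_def abs_mult)
qed

text \<open>\<open>Q - C \<eta>\<close> is nondecreasing, and it is positive far out because \<open>P \<ge> \<delta>\<close> means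
  \<open>Q \<ge> \<delta> x\<^bsup>a-1\<^esup>\<close>, which decays more slowly than \<open>\<eta>\<close>.\<close>

lemma Q_bounded_below:
  obtains x1 q where "x1 > 0" "q > 0" "\<And>x. x \<ge> x1 \<Longrightarrow> Q x \<ge> q"
proof -
  \<comment> \<open>With this choice the derivative of \<open>- C * \<eta> t\<close> is
    \<open>C0 * \<eta> t / t\<close>, enough to absorb the cross term in \<open>Q'\<close>.\<close>
  define C where "C = C0 / (1 + \<sigma> / 2)"
  have "C > 0"
    using C0_pos \<sigma>_pos by (simp add: C_def)
  have C: "C * (1 + \<sigma> / 2) = C0"
    using \<sigma>_pos by (simp add: C_def)
  have mono: "Q x - C * \<eta> x \<le> Q y - C * \<eta> y" if "0 < x" "x \<le> y" for x y
  proof (rule DERIV_nonneg_imp_nondecreasing[OF \<open>x \<le> y\<close>])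
    fix t assume "x \<le> t" "t \<le> y"
    then have t: "t > 0" using \<open>0 < x\<close> by simp
    define u where "u = \<alpha> * \<theta> t * (z t * v t / t)"
    have "(1 - a) * u \<le> \<bar>u\<bar>"
      using a_pos a_less_1 by (intro mult_le_abs) auto
    also have "\<dots> \<le> C0 * \<eta> t"
      unfolding u_def by (rule abs_cross_le[OF t])
    finally have "(1 - a) * u \<le> C0 * \<eta> t" .
    moreover have "0 \<le> (\<alpha> + a / 2) * \<theta> t * (v t)\<^sup>2"
      using \<alpha>_pos a_pos \<theta>_pos[OF t] by simp
    ultimately have nonneg: "0 \<le> ((\<alpha> + a / 2) * \<theta> t * (v t)\<^sup>2 - (1 - a) * u + C0 * \<eta> t) / t"
      using t by simp
    have "((\<lambda>x. Q x - C * \<eta> x) has_real_derivative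
        ((\<alpha> + a / 2) * \<theta> t * (v t)\<^sup>2 - (1 - a) * \<alpha> * \<theta> t * (z t * v t / t)) / t
        - C * (- (1 + \<sigma> / 2) * \<eta> t / t)) (at t)"
      by (intro DERIV_diff DERIV_cmult Q_deriv \<eta>_deriv t)
    moreover have "((\<alpha> + a / 2) * \<theta> t * (v t)\<^sup>2 - (1 - a) * \<alpha> * \<theta> t * (z t * v t / t)) / t
        - C * (- (1 + \<sigma> / 2) * \<eta> t / t)
      = ((\<alpha> + a / 2) * \<theta> t * (v t)\<^sup>2 - (1 - a) * u + C0 * \<eta> t) / t"
    proof -
      have "X / t - C * (- B * y / t) = (X + C * (B * y)) / t" for X B y
        by (simp add: add_divide_distrib)
      then show ?thesis
        unfolding C[symmetric] u_def by (simp only: mult.assoc)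
    qed
    ultimately show "\<exists>D. ((\<lambda>x. Q x - C * \<eta> x) has_real_derivative D) (at t) \<and> 0 \<le> D"
      using nonneg by metis
  qed
  obtain x0 \<delta> where x0: "x0 > 0" "\<delta> > 0" and P_ge: "\<And>x. x \<ge> x0 \<Longrightarrow> P x \<ge> \<delta>"
    using P_bounded_below by blast
  have "((\<lambda>x. C * x powr (- a - \<sigma> / 2)) \<longlongrightarrow> C * 0) at_top"
    using a_pos \<sigma>_pos by (intro tendsto_mult tendsto_const tendsto_neg_powr filterlim_ident) auto
  then have "eventually (\<lambda>x. C * x powr (- a - \<sigma> / 2) < \<delta>) at_top"
    using x0(2) by (intro order_tendstoD(2)) auto
  then obtain x1 where x1: "x1 \<ge> x0" "C * x1 powr (- a - \<sigma> / 2) < \<delta>"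
    using eventually_happens'[OF _ eventually_conj[OF _ eventually_ge_at_top[of x0]]]
    by (metis (mono_tags, lifting) trivial_limit_at_top_linorder)
  then have "x1 > 0" using x0(1) by simp
  \<comment> \<open>Factoring out \<open>x powr (a - 1)\<close>, the rate at which \<open>P\<close>
    bounds \<open>Q\<close> from below, leaves a factor that tends to 0.\<close>
  have "C * \<eta> x1 = x1 powr (a - 1) * (C * x1 powr (- a - \<sigma> / 2))"
    using \<open>x1 > 0\<close> by (simp add: \<eta>_def powr_add[symmetric] algebra_simps)
  also have "\<dots> < x1 powr (a - 1) * \<delta>"
    using x1(2) \<open>x1 > 0\<close> by simp
  also have "\<dots> \<le> x1 powr (a - 1) * P x1"
    using P_ge[OF x1(1)] by (intro mult_left_mono) auto
  also have "\<dots> = Q x1"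
    using \<open>x1 > 0\<close> by (simp add: P_def powr_add[symmetric] mult.assoc[symmetric])
  finally have "Q x1 - C * \<eta> x1 > 0" by simp
  moreover have "Q x \<ge> Q x1 - C * \<eta> x1" if "x \<ge> x1" for x
    using mono[OF \<open>x1 > 0\<close> that] mult_pos_pos[OF \<open>C > 0\<close> \<eta>_pos[of x]] that \<open>x1 > 0\<close> by simp
  ultimately show ?thesis
    using \<open>x1 > 0\<close> by (intro that[of x1 "Q x1 - C * \<eta> x1"]) auto
qed

section \<open>The virial argument\<close>

definition H :: "real \<Rightarrow> real \<Rightarrow> real" where
  "H t w = (k - t)\<^sup>2 - (1 - 2 * d) * (k - t) * w\<^sup>2 - 2 * d * t * w\<^sup>2"

text \<open>\<open>H\<close> is the leading part of \<open>x \<Psi>'\<close>. It is positive if \<open>v = 0\<close> (unless \<open>s = k\<close>, where \<open>F = 0\<close>)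
  and, thanks to \<open>v\<^sup>2 \<le> h\<close>, also if \<open>s = 0\<close>.\<close>

lemma virial_bound:
  assumes "q > 0"
  obtains C e where "0 \<le> C" "0 < e"
    "\<And>x. x > 0 \<Longrightarrow> F x \<ge> q \<Longrightarrow> e \<le> H (s x) (v x) + C * (\<theta> x * (v x)\<^sup>2)"
proof -
  define \<Phi> where "\<Phi> p = fst p powr c * ((snd p)\<^sup>2 + fst p - h) / 2 + \<kappa>" for p :: "real \<times> real"
  define B where "B = {0..h} \<times> {- (h + 1)..h + 1}"
  \<comment> \<open>A compact set holding all pairs \<open>(s x, v x)\<close> with
    \<open>F x \<ge> q\<close>. The strict energy bound is relaxed to make it closed, and the box
    \<open>B\<close> is wide enough since \<open>h \<le> (h + 1)\<^sup>2\<close>.\<close>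
  define K where "K = {p \<in> {p \<in> B. q \<le> \<Phi> p}. (snd p)\<^sup>2 + fst p \<le> h}"
  have c_powr: "continuous_on B (\<lambda>p. fst p powr c)"
    using c_pos by (intro continuous_on_powr' continuous_intros) (auto simp: B_def)
  have "continuous_on B \<Phi>"
    unfolding \<Phi>_def by (intro continuous_intros c_powr) auto
  moreover have "closed B"
    unfolding B_def by (intro closed_Times closed_real_atLeastAtMost)
  ultimately have closed: "closed {p \<in> B. q \<le> \<Phi> p}"
    by (intro continuous_on_closed_Collect_le continuous_on_const) assumption+
  have "closed K"
    unfolding K_def by (rule continuous_on_closed_Collect_le[OF _ _ closed]) (intro continuous_intros)+
  moreover have "bounded K"
    by (rule bounded_subset[of B]) (auto simp: K_def B_def intro!: bounded_Times)
  ultimately have "compact K"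
    by (simp add: compact_eq_bounded_closed)
  moreover have "continuous_on K (\<lambda>p. H (fst p) (snd p))"
    unfolding H_def by (intro continuous_intros)
  moreover have "continuous_on K (\<lambda>p. fst p powr c * (snd p)\<^sup>2)"
    by (intro continuous_intros continuous_on_subset[OF c_powr]) (auto simp: K_def)
  moreover have "0 \<le> fst p powr c * (snd p)\<^sup>2" for p :: "real \<times> real"
    by simp
  moreover have "0 < H (fst p) (snd p)" if "p \<in> K" and "fst p powr c * (snd p)\<^sup>2 = 0" for p
  proof -
    obtain t w where p: "p = (t, w)" by (cases p)
    have tw: "w\<^sup>2 + t \<le> h" "q \<le> t powr c * (w\<^sup>2 + t - h) / 2 + \<kappa>"
      using \<open>p \<in> K\<close> by (auto simp: K_def \<Phi>_def p)
    consider "t = 0" | "w = 0"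
      using \<open>fst p powr c * (snd p)\<^sup>2 = 0\<close> by (auto simp: p)
    then show ?thesis
    proof cases
      case 1
      \<comment> \<open>For \<open>t = 0\<close>, \<open>H\<close> is
        \<open>k * (k - (1 - 2 * d) * w\<^sup>2)\<close>, so the bound on \<open>w\<^sup>2\<close>
        must be played against \<open>k = (1 - d) * h\<close>.\<close>
      have "(1 - 2 * d) * w\<^sup>2 \<le> (1 - 2 * d) * h"
        using tw(1) 1 d_less by (intro mult_left_mono) auto
      also have "\<dots> < k"
        using d_pos h_pos by (simp add: k_def)
      finally have "k * ((1 - 2 * d) * w\<^sup>2) < k * k"
        using k_pos by simp
      then show ?thesis
        using 1 by (simp add: p H_def power2_eq_square mult.left_commute mult.commute)
    next
      case 2
      then have "t \<noteq> k"
        using tw(2) \<open>q > 0\<close> by (auto simp: \<kappa>_def field_simps)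
      then show ?thesis
        using 2 by (simp add: p H_def)
    qed
  qed
  ultimately obtain C e where Ce: "0 \<le> C" "0 < e"
    "\<And>p. p \<in> K \<Longrightarrow> e \<le> H (fst p) (snd p) + C * (fst p powr c * (snd p)\<^sup>2)"
    by (rule compact_penalty) auto
  have "(s x, v x) \<in> K" if "x > 0" "F x \<ge> q" for x
  proof -
    have "\<bar>v x\<bar> \<le> h + 1"
    proof (rule power2_le_imp_le[of "\<bar>v x\<bar>"])
      show "\<bar>v x\<bar>\<^sup>2 \<le> (h + 1)\<^sup>2"
        unfolding power2_abs power2_sum
        using v_sq_less[OF that(1)] h_pos zero_le_power2[of h]
        by (simp only: power_one mult_1_right)
    qed (use h_pos in simp)
    then show ?thesis
      using bound[OF that(1)] s_pos[OF that(1)] s_less[OF that(1)] that(2)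
      by (auto simp: K_def B_def \<Phi>_def F_def \<theta>_def)
  qed
  then show ?thesis
    using Ce(3)[of "(s _, v _)"] by (intro that[OF Ce(1,2)]) (auto simp: \<theta>_def)
qed

text \<open>Up to a constant factor this is \<open>(k - s) (z\<^sup>2)' / x\<close>, whose derivative contains the restoring force squared.\<close>

definition \<Psi> :: "real \<Rightarrow> real" where "\<Psi> x = (k - s x) * (z x * v x / x)"

lemma \<Psi>_deriv:
  assumes "x > 0"
  shows "(\<Psi> has_real_derivative
    (H (s x) (v x) - (\<sigma> * s x + k - s x) * (z x * v x / x)) / x) (at x)"
proof -
  have "(\<Psi> has_real_derivative
      (0 - (\<sigma> * s x / x + 2 * d * v x * s x / z x)) * (z x * v x / x)
      + ((k - s x - (1 - 2 * d) * (v x)\<^sup>2) - z x * v x / x) / x * (k - s x)) (at x)"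
    unfolding \<Psi>_def[abs_def]
    by (intro DERIV_mult DERIV_diff DERIV_const zv_deriv s_deriv assms)
  then show ?thesis
    using assms z_pos[OF assms]
    by (elim DERIV_cong) (simp add: H_def field_simps power2_eq_square)
qed

lemma no_good_solution: False
proof -
  obtain x1 q where x1: "x1 > 0" "q > 0" and Q_ge: "\<And>x. x \<ge> x1 \<Longrightarrow> Q x \<ge> q"
    using Q_bounded_below by blast
  obtain C e where Ce: "0 \<le> C" "0 < e"
    and virial: "\<And>x. x > 0 \<Longrightarrow> F x \<ge> q / 2 \<Longrightarrow> e \<le> H (s x) (v x) + C * (\<theta> x * (v x)\<^sup>2)"
    using virial_bound[of "q / 2"] \<open>q > 0\<close> by auto
  \<comment> \<open>The \<open>v\<^sup>2\<close> term of \<open>K * Q'\<close> is then exactly the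
    penalty that \<open>virial\<close> asks for.\<close>
  define K where "K = C / (\<alpha> + a / 2)"
  have "K \<ge> 0" and K: "K * (\<alpha> + a / 2) = C"
    using Ce(1) \<alpha>_pos a_pos by (auto simp: K_def)
  \<comment> \<open>Collects the coefficients of \<open>\<eta>\<close> in the bounds for the cross
    terms of \<open>K * Q'\<close> and \<open>\<Psi>'\<close>.\<close>
  define M where "M = K * C0 + (\<sigma> * h + k + h) * h"
  have "eventually (\<lambda>x. C0 * \<eta> x < q / 2 \<and> M * \<eta> x < e / 2 \<and> 1 * \<eta> x < 1 \<and> x > x1) at_top"
    using x1(2) Ce(2) by (intro eventually_conj eventually_\<eta>_less eventually_gt_at_top) auto
  then obtain x2 where x2: "\<And>x. x \<ge> x2 \<Longrightarrow>
      C0 * \<eta> x < q / 2 \<and> M * \<eta> x < e / 2 \<and> \<eta> x < 1 \<and> x > x1"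
    by (auto simp: eventually_at_top_linorder)
  \<comment> \<open>Of the virial gain \<open>e\<close>, one half pays for the cross terms and the
    other half drives the logarithm.\<close>
  define T where "T x = K * Q x + \<Psi> x - e / 2 * ln x" for x
  have T_mono: "T x2 \<le> T x" if "x \<ge> x2" for x
  proof (rule DERIV_nonneg_imp_nondecreasing[OF that])
    fix t assume "x2 \<le> t"
    then have t: "t > 0" "t \<ge> x1" and \<eta>: "C0 * \<eta> t < q / 2" "M * \<eta> t < e / 2"
      using x2[of t] x1(1) by auto
    define u where "u = z t * v t / t"
    have u: "\<bar>\<alpha> * \<theta> t * u\<bar> \<le> C0 * \<eta> t" "\<bar>u\<bar> \<le> h * \<eta> t"
      using abs_cross_le[OF t(1)] abs_zv_le_\<eta>[OF t(1)] by (simp_all only: u_def)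
    have "F t \<ge> q / 2"
      using Q_ge[OF t(2)] u(1) \<eta>(1) by (simp only: Q_def u_def)
    then have vir: "e \<le> H (s t) (v t) + C * (\<theta> t * (v t)\<^sup>2)"
      by (rule virial[OF t(1)])
    have "(1 - a) * (\<alpha> * \<theta> t * u) \<le> C0 * \<eta> t"
      using a_pos a_less_1 by (intro order_trans[OF mult_le_abs u(1)]) auto
    then have 1: "K * ((1 - a) * (\<alpha> * \<theta> t * u)) \<le> K * (C0 * \<eta> t)"
      using \<open>K \<ge> 0\<close> by (intro mult_left_mono) auto
    have "\<bar>\<sigma> * s t + k - s t\<bar> \<le> \<sigma> * h + k + h"
    proof -
      have "\<sigma> * s t \<le> \<sigma> * h" "0 \<le> \<sigma> * s t"
        using s_less[OF t(1)] s_pos[OF t(1)] \<sigma>_pos by auto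
      then show ?thesis
        using s_less[OF t(1)] s_pos[OF t(1)] k_pos by linarith
    qed
    then have "\<bar>\<sigma> * s t + k - s t\<bar> * \<bar>u\<bar> \<le> (\<sigma> * h + k + h) * (h * \<eta> t)"
      using u(2) by (intro mult_mono) auto
    then have 2: "(\<sigma> * s t + k - s t) * u \<le> (\<sigma> * h + k + h) * (h * \<eta> t)"
      using abs_ge_self[of "(\<sigma> * s t + k - s t) * u"] by (simp add: abs_mult)
    have 3: "K * (C0 * \<eta> t) + (\<sigma> * h + k + h) * (h * \<eta> t) < e / 2"
      using \<eta>(2) by (simp add: M_def algebra_simps)
    have nonneg: "0 \<le> (C * (\<theta> t * (v t)\<^sup>2) - K * ((1 - a) * (\<alpha> * \<theta> t * u))
        + H (s t) (v t) - (\<sigma> * s t + k - s t) * u - e / 2) / t"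
      using vir 1 2 3 t(1) by (intro divide_nonneg_pos) linarith+
    have "(T has_real_derivative
        K * (((\<alpha> + a / 2) * \<theta> t * (v t)\<^sup>2 - (1 - a) * \<alpha> * \<theta> t * (z t * v t / t)) / t)
        + (H (s t) (v t) - (\<sigma> * s t + k - s t) * (z t * v t / t)) / t
        - e / 2 * (1 / t)) (at t)"
      unfolding T_def[abs_def]
      by (intro DERIV_diff DERIV_add DERIV_cmult Q_deriv \<Psi>_deriv DERIV_ln_divide t(1))
    moreover have "K * (((\<alpha> + a / 2) * \<theta> t * (v t)\<^sup>2 - (1 - a) * \<alpha> * \<theta> t * (z t * v t / t)) / t)
        + (H (s t) (v t) - (\<sigma> * s t + k - s t) * (z t * v t / t)) / t - e / 2 * (1 / t)
      = (C * (\<theta> t * (v t)\<^sup>2) - K * ((1 - a) * (\<alpha> * \<theta> t * u))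
        + H (s t) (v t) - (\<sigma> * s t + k - s t) * u - e / 2) / t"
    proof -
      have "K * (X / t) + Y / t - e / 2 * (1 / t) = (K * X + Y - e / 2) / t" for X Y
        by (simp add: add_divide_distrib diff_divide_distrib)
      moreover have "K * ((\<alpha> + a / 2) * \<theta> t * (v t)\<^sup>2 - (1 - a) * \<alpha> * \<theta> t * u)
          = C * (\<theta> t * (v t)\<^sup>2) - K * ((1 - a) * (\<alpha> * \<theta> t * u))"
        unfolding K[symmetric] by (simp only: right_diff_distrib mult.assoc)
      ultimately show ?thesis
        unfolding u_def[symmetric] by (simp only: add_diff_eq)
    qed
    ultimately show "\<exists>D. (T has_real_derivative D) (at t) \<and> 0 \<le> D"
      using nonneg by metis
  qed
  have bounded: "K * Q x + \<Psi> x \<le> K * (\<kappa> + C0) + (k + h) * h" if "x \<ge> x2" for x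
  proof -
    have x: "x > 0" and "\<eta> x < 1"
      using x2[OF that] x1(1) by auto
    have "\<theta> x * ((v x)\<^sup>2 + s x - h) \<le> 0"
      using bound[OF x] \<theta>_pos[OF x] by (intro mult_nonneg_nonpos) auto
    moreover have "C0 * \<eta> x \<le> C0 * 1"
      using \<open>\<eta> x < 1\<close> C0_pos by (intro mult_left_mono) auto
    ultimately have "Q x \<le> \<kappa> + C0"
      using abs_cross_le[OF x] unfolding Q_def F_def by linarith
    then have "K * Q x \<le> K * (\<kappa> + C0)"
      using \<open>K \<ge> 0\<close> by (rule mult_left_mono)
    moreover have "\<bar>k - s x\<bar> \<le> k + h"
      using s_pos[OF x] s_less[OF x] k_pos by linarith
    then have "\<bar>k - s x\<bar> * \<bar>z x * v x / x\<bar> \<le> (k + h) * (h * 1)"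
      using h_pos k_pos \<eta>_pos[OF x] \<open>\<eta> x < 1\<close>
      by (intro mult_mono order_trans[OF abs_zv_le_\<eta>[OF x]]) auto
    then have "\<Psi> x \<le> (k + h) * h"
      using abs_ge_self[of "\<Psi> x"] by (simp add: \<Psi>_def abs_mult)
    ultimately show ?thesis by simp
  qed
  define N where "N = K * (\<kappa> + C0) + (k + h) * h - T x2"
  have ln_le: "e / 2 * ln x \<le> N" if "x \<ge> x2" for x
    using T_mono[OF that] bounded[OF that] by (simp add: T_def N_def)
  \<comment> \<open>At this point \<open>e / 2 * ln x\<close> is at least
    \<open>N + e / 2\<close>.\<close>
  have "e / 2 * ln (max x2 (exp (2 * N / e + 1))) \<le> N"
    by (intro ln_le) simp
  moreover have "2 * N / e + 1 \<le> ln (max x2 (exp (2 * N / e + 1)))"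
    by (subst ln_ge_iff) (auto simp: less_max_iff_disj)
  then have "e / 2 * (2 * N / e + 1) \<le> e / 2 * ln (max x2 (exp (2 * N / e + 1)))"
    using Ce(2) by (intro mult_left_mono) auto
  ultimately show False
    using Ce(2) by (simp add: algebra_simps)
qed

end

section \<open>From good profiles to phase variables\<close>

lemma has_halfline_deriv:
  assumes "g differentiable_on {0..}" "x \<ge> 0"
  shows "(g has_real_derivative halfline_deriv g x) (at x within {0..})"
  using assms unfolding halfline_deriv_def has_real_derivative_iff_has_vector_derivative
  by (intro vector_derivative_works[THEN iffD1]) (auto simp: differentiable_on_def)

lemma has_halfline_deriv_at:
  assumes "g differentiable_on {0..}" "x > 0"
  shows "(g has_real_derivative halfline_deriv g x) (at x)"
  using has_halfline_deriv[OF assms(1), of x] at_within_interior[of x "{0..}"] assms(2) by simp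

lemma halfline_deriv_eqI:
  assumes "(g has_real_derivative D) (at 0 within {0..})"
  shows "halfline_deriv g 0 = D"
  unfolding halfline_deriv_def
  using assms by (intro vector_derivative_within)
    (auto simp: has_real_derivative_iff_has_vector_derivative at_within_Ici_at_right)

lemma differentiable_on_halfline_tendsto:
  fixes g :: "real \<Rightarrow> real"
  assumes "g differentiable_on {0..}"
  shows "(g \<longlongrightarrow> g 0) (at_right 0)"
  using differentiable_imp_continuous_on[OF assms]
  by (simp add: continuous_on_def at_within_Ici_at_right[symmetric])

text \<open>The value of \<open>d\<close> gives \<open>f = g powr (1 - 2 * d)\<close>, so that
  \<open>f\<close>, \<open>g\<close> and \<open>z\<close> are powers of one another and combine
  rationally; the third parameter of the locale then makes \<open>k\<close> equal to
  \<open>1 / (m - 1)\<close>.\<close>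

lemma good_solution_of_profile:
  assumes m: "m > 1" and \<sigma>: "\<sigma> > 0" and good: "good_profile m \<sigma> f" and pos: "\<And>x. x > 0 \<Longrightarrow> f x > 0"
  defines "d \<equiv> (m - 1) / (2 * m)"
  defines "g \<equiv> \<lambda>x. f x powr m"
  defines "z \<equiv> \<lambda>x. g x powr d" and "v \<equiv> \<lambda>x. halfline_deriv g x * g x powr (d - 1)"
  shows "good_solution d (1 / ((m - 1) * (1 - d))) \<sigma> z v (g 0 powr d)"
proof -
  have d: "0 < d" "d < 1 / 2" and dm: "m * (1 - 2 * d) = 1"
    using m by (auto simp: d_def field_simps)
  define g1 g2 where "g1 = halfline_deriv g" and "g2 = halfline_deriv g1"
  have diff: "g differentiable_on {0..}" "g1 differentiable_on {0..}"
    using good by (simp_all add: good_profile_def profile_def C2_halfline_def g1_def g_def)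
  have g_pos: "g x > 0" if "x > 0" for x
    using pos[OF that] by (simp add: g_def)
  have g_deriv: "(g has_real_derivative g1 x) (at x)"
    and g1_deriv: "(g1 has_real_derivative g2 x) (at x)" if "x > 0" for x
    unfolding g1_def g2_def using diff that
    by (auto intro!: has_halfline_deriv_at simp: g1_def)
  have ode: "g2 x = 1 / (m - 1) * f x - x powr \<sigma> * g x" if "x > 0" for x
  proof -
    have "g2 x - 1 / (m - 1) * f x + x powr \<sigma> * g x = 0"
      using good that by (simp add: good_profile_def profile_def g1_def g2_def g_def)
    then show ?thesis by linarith
  qed
  have g1_0: "g1 0 = 0"
    unfolding g1_def
  proof (rule halfline_deriv_eqI)
    \<comment> \<open>(P2) states the claim directly; under (P1) it follows by the chain rule,
      \<open>f 0\<close> being positive.\<close>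
    from good consider "f 0 > 0" "(f has_real_derivative 0) (at 0 within {0..})"
      | "(g has_real_derivative 0) (at 0 within {0..})"
      by (auto simp: good_profile_def g_def)
    then show "(g has_real_derivative 0) (at 0 within {0..})"
    proof cases
      case 1
      show ?thesis
        unfolding g_def
        using DERIV_chain'[OF 1(2) has_real_derivative_powr[OF 1(1), of m]] by simp
    qed
  qed
  show ?thesis
  proof
    show "0 < d" "d < 1 / 2" "0 < \<sigma>" by fact+
    show "0 < 1 / ((m - 1) * (1 - d))"
      using m d by simp
    fix x :: real assume x: "0 < x"
    show "0 < z x"
      using g_pos[OF x] by (simp add: z_def)
    note [derivative_intros] = g_deriv[OF x] g1_deriv[OF x]
    have pow: "g x powr (d - 1) = z x / g x" "g x powr (d - 1 - 1) = z x / (g x * g x)"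
      using g_pos[OF x] by (simp_all add: z_def powr_diff power2_eq_square)
    have "(z has_real_derivative d * g x powr (d - 1) * g1 x) (at x)"
      unfolding z_def using g_pos[OF x] by (auto intro!: derivative_eq_intros)
    then show "(z has_real_derivative d * v x) (at x)"
      by (elim DERIV_cong) (simp add: v_def g1_def)
    have v_deriv: "(v has_real_derivative
        g2 x * g x powr (d - 1) + (d - 1) * g x powr (d - 1 - 1) * g1 x * g1 x) (at x)"
      unfolding v_def g1_def[symmetric] using g_pos[OF x] by (auto intro!: derivative_eq_intros)
    have "f x * z x * z x = g x"
    proof -
      have "f x = g x powr (1 - 2 * d)"
        unfolding g_def powr_powr dm using pos[OF x] by simp
      then show ?thesis
        using g_pos[OF x] by (simp add: z_def powr_add[symmetric])
    qed
    then have f_eq: "f x = g x / (z x * z x)"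
      using \<open>0 < z x\<close> by (simp add: field_simps)
    have "(1 - d) * (1 / ((m - 1) * (1 - d)) - w) = 1 / (m - 1) - (1 - d) * w" for w
      using d nonzero_mult_divide_mult_cancel_right[of "1 - d" 1 "m - 1"]
      by (simp only: right_diff_distrib times_divide_eq_right mult_1_right mult_1_left)
    moreover have "(A * f x - B * g x) * (z x / g x) + (d - 1) * (z x / (g x * g x)) * y * y
        = (A - (1 - d) * (y * (z x / g x))\<^sup>2 - B * (z x)\<^sup>2) / z x" for A B y
      unfolding f_eq using \<open>0 < z x\<close> g_pos[OF x] by (simp add: field_simps power2_eq_square)
    ultimately have "g2 x * g x powr (d - 1) + (d - 1) * g x powr (d - 1 - 1) * g1 x * g1 x
      = ((1 - d) * (1 / ((m - 1) * (1 - d)) - (v x)\<^sup>2) - x powr \<sigma> * (z x)\<^sup>2) / z x"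
      unfolding v_def g1_def[symmetric] pow ode[OF x] by (simp only:)
    with v_deriv show "(v has_real_derivative
        ((1 - d) * (1 / ((m - 1) * (1 - d)) - (v x)\<^sup>2) - x powr \<sigma> * (z x)\<^sup>2) / z x) (at x)"
      by (rule DERIV_cong)
  next
    have "eventually (\<lambda>x. 0 \<le> g x) (at_right 0)"
      by (simp add: g_def)
    then show "(z \<longlongrightarrow> g 0 powr d) (at_right 0)"
      unfolding z_def using d(1)
      by (intro tendsto_powr' differentiable_on_halfline_tendsto diff tendsto_const disjI2 conjI)
    have "(g1 \<longlongrightarrow> 0) (at_right 0)"
      using differentiable_on_halfline_tendsto[OF diff(2)] g1_0 by simp
    moreover have "eventually (\<lambda>x. g1 x = z x powr ((1 - d) / d) * v x) (at_right 0)"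
      using eventually_at_right_less[of "0::real"]
    proof eventually_elim
      case (elim x)
      \<comment> \<open>For \<open>c = (1 - d) / d\<close> the exponent of \<open>g x\<close> is 0,
        so the flux is exactly \<open>g1 x\<close>.\<close>
      have "z x powr c * v x = g1 x * (g x powr (d * c + (d - 1)))" for c
        by (simp add: z_def v_def g1_def powr_powr powr_add)
      moreover have "d * ((1 - d) / d) + (d - 1) = 0"
        using d by simp
      ultimately show ?case
        using g_pos[OF elim] by (simp only: powr_zero_eq_one) simp
    qed
    ultimately show "((\<lambda>x. z x powr ((1 - d) / d) * v x) \<longlongrightarrow> 0) (at_right 0)"
      by (rule Lim_transform_eventually)
  qed
qed

theorem theorem1p4:
  fixes m \<sigma> :: real
  assumes "m > 1" and "\<sigma> > 0"
  shows "\<not> (\<exists>f :: real \<Rightarrow> real. good_profile m \<sigma> f \<and> (\<forall>\<xi>>0. f \<xi> > 0))"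
  using good_solution.no_good_solution[OF good_solution_of_profile[OF assms]] by blast

end
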